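(* Let $A,B:\mathbb{R}^m_{>0}\to\mathbb{S}^n$ be continuously differentiable symmetric-matrix-valued functions such that $B(\boldsymbol{x})\succ 0$ for every $\boldsymbol{x}\in\mathbb{R}^m_{>0}$. Write $\lambda_1^{A,B}(\boldsymbol{x})$ for the maximum generalized eigenvalue of the pair $(A(\boldsymbol{x}),B(\boldsymbol{x}))$. Fix $\boldsymbol{x}\in\mathbb{R}^m_{>0}$, let $t$ be the multiplicity of the maximum generalized eigenvalue $\lambda_1^{A,B}(\boldsymbol{x})$, and let $V=[\boldsymbol{v}_1,\ldots,\boldsymbol{v}_t]\in\mathbb{R}^{n\times t}$ be a matrix whose columns are corresponding generalized eigenvectors satisfying $V^{\mathrm T}B(\boldsymbol{x})V=I$. Then the Clarke subdifferential of the function $\lambda_1^{A,B}(\cdot)$ at $\boldsymbol{x}$ is $$\partial\lambda_1^{A,B}(\boldsymbol{x})=\left\{\boldsymbol{g}\in\mathbb{R}^m \;\middle|\; \boldsymbol{g}=\left[\left\langle U,\;V^{\mathrm T}\left(\frac{\partial A(\boldsymbol{x})}{\partial x_e}-\lambda_1^{A,B}(\boldsymbol{x})\frac{\partial B(\boldsymbol{x})}{\partial x_e}\right)V\right\rangle\right]_{e=1}^m,\ U\in\Upsilon_t\right\},$$ where $\Upsilon_t=\{X\in\mathbb{S}^t\mid X\succeq 0,\ \mathrm{tr}(X)=1\}$.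
   Context: $\mathbb{R}^m_{>0}$ is the set of real $m$-vectors with all components positive; $\mathbb{S}^n$ is the space of real symmetric $n\times n$ matrices; $X\succ0$ (resp. $X\succeq 0$) means positive definite (resp. positive semidefinite); $\langle X,Y\rangle=\mathrm{tr}(XY)$ for symmetric matrices; $[a_e]_{e=1}^m$ is the vector in $\mathbb{R}^m$ whose $e$-th component is $a_e$. Generalized eigenvalues: for $X,Y\in\mathbb{S}^n$ with $Y\succ 0$, the generalized eigenvalues of $(X,Y)$ are the $\lambda_i\in\mathbb{R}$ with $X\boldsymbol{v}_i=\lambda_iY\boldsymbol{v}_i$ for some nonzero $\boldsymbol{v}_i\in\mathbb{R}^n$ (a generalized eigenvector). Counted with multiplicity there are $n$ of them (they are the eigenvalues of $Y^{-1/2}XY^{-1/2}$), ordered $\lambda_1(X,Y)\ge\cdots\ge\lambda_n(X,Y)$. Set $\lambda_i^{A,B}(\boldsymbol{x})=\lambda_i(A(\boldsymbol{x}),B(\boldsymbol{x}))$. The multiplicity $t$ of $\lambda_1^{A,B}(\boldsymbol{x})$ is the number of indices $i$ with $\lambda_i^{A,B}(\boldsymbol{x})=\lambda_1^{A,B}(\boldsymbol{x})$. Clarke subdifferential: for a locally Lipschitz continuous function $f$ on an open subset of $\mathbb{R}^m$, $\partial f(\boldsymbol{x})$ is the convex hull of all limits $\lim_{i\to\infty}\nabla f(\boldsymbol{x}^i)$ taken over sequences $\boldsymbol{x}^i\to\boldsymbol{x}$ of points at which $f$ is differentiable and for which the limit exists. (The function $\lambda_1^{A,B}$ is locally Lipschitz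 continuous on $\mathbb{R}^m_{>0}$.) *)

theory Defs
  imports "HOL-Analysis.Analysis" "HOL-Library.Multiset"
begin

definition pos_orthant :: "(real ^ 'm) set" where
  "pos_orthant = {x. \<forall>e. 0 < x $ e}"

definition sym_mat :: "real ^ 'n ^ 'n \<Rightarrow> bool" where
  "sym_mat X \<longleftrightarrow> transpose X = X"

definition pos_def :: "real ^ 'n ^ 'n \<Rightarrow> bool" where
  "pos_def X \<longleftrightarrow> sym_mat X \<and> (\<forall>v. v \<noteq> 0 \<longrightarrow> 0 < v \<bullet> (X *v v))"

definition pos_semidef :: "real ^ 'n ^ 'n \<Rightarrow> bool" where
  "pos_semidef X \<longleftrightarrow> sym_mat X \<and> (\<forall>v. 0 \<le> v \<bullet> (X *v v))"

(* The trace inner product; only meant for symmetric matrices. *)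
definition mat_inner :: "real ^ 'n ^ 'n \<Rightarrow> real ^ 'n ^ 'n \<Rightarrow> real" where
  "mat_inner X Y = trace (X ** Y)"

definition is_gen_eigenvector :: "real ^ 'n ^ 'n \<Rightarrow> real ^ 'n ^ 'n \<Rightarrow> real \<Rightarrow> real ^ 'n \<Rightarrow> bool" where
  "is_gen_eigenvector X Y \<mu> v \<longleftrightarrow> v \<noteq> 0 \<and> X *v v = \<mu> *\<^sub>R (Y *v v)"

definition is_gen_eigenvalue :: "real ^ 'n ^ 'n \<Rightarrow> real ^ 'n ^ 'n \<Rightarrow> real \<Rightarrow> bool" where
  "is_gen_eigenvalue X Y \<mu> \<longleftrightarrow> (\<exists>v. is_gen_eigenvector X Y \<mu> v)"

(* Each generalized eigenvalue is repeated as often as the dimension of its eigenspace.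
   For X symmetric and Y positive definite there are finitely many of them, the
   multiset has CARD('n) elements, and it is the multiset of eigenvalues of the
   symmetric matrix Y^(-1/2) X Y^(-1/2): the map v -> Y^(1/2) v identifies the
   eigenspaces, and for symmetric matrices geometric and algebraic multiplicities
   agree. *)
definition gen_eigenvalues :: "real ^ 'n ^ 'n \<Rightarrow> real ^ 'n ^ 'n \<Rightarrow> real multiset" where
  "gen_eigenvalues X Y =
     (\<Sum>\<mu> \<in> {\<mu>. is_gen_eigenvalue X Y \<mu>}.
        replicate_mset (dim {v. X *v v = \<mu> *\<^sub>R (Y *v v)}) \<mu>)"

(* In decreasing order, with indices 1, ..., CARD('n). *)
definition gen_eigval :: "nat \<Rightarrow> real ^ 'n ^ 'n \<Rightarrow> real ^ 'n ^ 'n \<Rightarrow> real" where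
  "gen_eigval i X Y = rev (sorted_list_of_multiset (gen_eigenvalues X Y)) ! (i - 1)"

definition max_gen_eigval_mult :: "real ^ 'n ^ 'n \<Rightarrow> real ^ 'n ^ 'n \<Rightarrow> nat" where
  "max_gen_eigval_mult X Y = card {i \<in> {1..CARD('n)}. gen_eigval i X Y = gen_eigval 1 X Y}"

(* Continuous differentiability; only meant for open S. *)
definition cont_diff_on ::
    "'a::real_normed_vector set \<Rightarrow> ('a \<Rightarrow> 'b::real_normed_vector) \<Rightarrow> bool" where
  "cont_diff_on S F \<longleftrightarrow>
     (\<exists>F' :: 'a \<Rightarrow> 'a \<Rightarrow>\<^sub>L 'b.
        (\<forall>x\<in>S. (F has_derivative blinfun_apply (F' x)) (at x)) \<and> continuous_on S F')"

definition partial_deriv ::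
    "'m \<Rightarrow> (real ^ 'm \<Rightarrow> 'b::real_normed_vector) \<Rightarrow> real ^ 'm \<Rightarrow> 'b" where
  "partial_deriv e F x = vector_derivative (\<lambda>s. F (x + s *\<^sub>R axis e 1)) (at 0)"

(* The Clarke subdifferential at x of a locally Lipschitz function f on the open set S;
   the values of f outside S are irrelevant. *)
definition clarke_subdiff ::
    "'a::real_inner set \<Rightarrow> ('a \<Rightarrow> real) \<Rightarrow> 'a \<Rightarrow> 'a set" where
  "clarke_subdiff S f x =
     convex hull {g. \<exists>X G. (\<forall>i::nat. X i \<in> S \<and> (GDERIV f (X i) :> G i)) \<and>
                           X \<longlonglongrightarrow> x \<and> G \<longlonglongrightarrow> g}"

definition spectraplex :: "(real ^ 't ^ 't) set" where
  "spectraplex = {U. pos_semidef U \<and> trace U = 1}"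

end

theory Submission
  imports Defs
begin

text \<open>The maximum generalized eigenvalue is the maximum of the Rayleigh quotients over the unit sphere,
  that is, of a compact family of continuously differentiable functions. For such a maximum function the
  Clarke subdifferential is the convex hull of the gradients of the functions attaining the maximum.
  Here these are indexed by the unit vectors of the top eigenspace, that is, up to scaling, by
  \<open>V *v u\<close> with \<open>norm u = 1\<close>, and their gradients are the images of the rank one matrices
  \<open>u u\<^sup>T\<close> under the linear map \<open>U \<mapsto> g\<close> of the theorem. The convex hull of these matrices is the spectraplex.\<close>

section \<open>Clarke subdifferentials of maximum functions\<close>

text \<open>The sphere is the Euclidean one and the quotient carries the denominator because the
  index set must not move with \<open>y\<close>, as the normalisation by \<open>B y\<close> would.
  Scale invariance of the quotient and of its gradient translates between the two normalisations at
  \<open>x\<close>. With the vector held fixed, nothing has to be known about how eigenvectors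
  depend on \<open>y\<close>; where the multiplicity changes they cannot in general be followed
  continuously. The hard inclusion is that active gradients lie in the hull of the limiting ones. An
  active gradient need not itself be a limiting one: with \<open>B\<close> the identity and
  \<open>A\<close> diagonal with entries \<open>y - 1\<close> and \<open>1 - y\<close>, the
  gradients near 1 are only 1 and -1, whereas the active unit vectors give all of [-1, 1]. So the
  hulls are compared through their support functions: in each direction some limiting gradient must
  be at least as steep as any active one.\<close>

lemma GDERIV_touching:
  fixes h k :: "'a::euclidean_space \<Rightarrow> real"
  assumes "open S" "y \<in> S" "GDERIV h y :> a" "GDERIV k y :> b"
    and "\<And>z. z \<in> S \<Longrightarrow> h z \<le> k z" "h y = k y"
  shows "a = b"
proof -
  have "GDERIV (\<lambda>z. k z - h z) y :> b - a"
    using assms by (intro GDERIV_diff)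
  then have "(\<lambda>v. v \<bullet> (b - a)) = (\<lambda>v. 0)"
    unfolding gderiv_def
    by (rule differential_zero_maxmin[OF \<open>y \<in> S\<close> \<open>open S\<close>]) (use assms in auto)
  then have "(b - a) \<bullet> (b - a) = 0" by metis
  then show ?thesis by simp
qed

text \<open>The outer functions touch at \<open>y\<close>, so their gradients agree, and the error
  of \<open>f\<close> against the common linear part lies between theirs. Differentiability of
  \<open>f\<close> is a conclusion.\<close>

lemma GDERIV_sandwich:
  fixes f h k :: "'a::euclidean_space \<Rightarrow> real"
  assumes "open S" "y \<in> S"
    and h: "GDERIV h y :> a" and k: "GDERIV k y :> b"
    and le: "\<And>z. z \<in> S \<Longrightarrow> h z \<le> f z" "\<And>z. z \<in> S \<Longrightarrow> f z \<le> k z"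
    and eq: "h y = f y" "k y = f y"
  shows "GDERIV f y :> b"
proof -
  have ab: "a = b"
    by (rule GDERIV_touching[OF assms(1,2) h k]) (use order_trans[OF le] eq in auto)
  show ?thesis
    unfolding gderiv_def has_derivative_at_alt
  proof (intro conjI allI impI)
    show "bounded_linear (\<lambda>h. h \<bullet> b)" by (rule bounded_linear_inner_left)
    fix e :: real assume "e > 0"
    obtain d1 where d1: "d1 > 0" "\<And>z. norm (z - y) < d1 \<Longrightarrow> norm (h z - h y - (z - y) \<bullet> b) \<le> e * norm (z - y)"
      using h \<open>e > 0\<close> ab unfolding gderiv_def has_derivative_at_alt by blast
    obtain d2 where d2: "d2 > 0" "\<And>z. norm (z - y) < d2 \<Longrightarrow> norm (k z - k y - (z - y) \<bullet> b) \<le> e * norm (z - y)"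
      using k \<open>e > 0\<close> unfolding gderiv_def has_derivative_at_alt by blast
    obtain d3 where d3: "d3 > 0" "ball y d3 \<subseteq> S"
      using assms(1,2) open_contains_ball by blast
    show "\<exists>d>0. \<forall>z. norm (z - y) < d \<longrightarrow> norm (f z - f y - (z - y) \<bullet> b) \<le> e * norm (z - y)"
    proof (intro exI[of _ "min d1 (min d2 d3)"] conjI allI impI)
      show "min d1 (min d2 d3) > 0" using d1 d2 d3 by simp
      fix z assume z: "norm (z - y) < min d1 (min d2 d3)"
      then have "z \<in> S" using d3 by (auto simp: dist_norm norm_minus_commute subset_iff)
      then show "norm (f z - f y - (z - y) \<bullet> b) \<le> e * norm (z - y)"
        using le[of z] d1(2)[of z] d2(2)[of z] z eq by (auto simp: abs_le_iff)
    qed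
  qed
qed

section \<open>The set of limiting gradients\<close>

lemma limiting_gradients_iff:
  "(\<exists>X G. (\<forall>i::nat. X i \<in> S \<and> (GDERIV f (X i) :> G i)) \<and> X \<longlonglongrightarrow> x \<and> G \<longlonglongrightarrow> g) \<longleftrightarrow>
   (\<forall>e>0. \<exists>y\<in>S. \<exists>h. (GDERIV f y :> h) \<and> dist y x < e \<and> dist h g < e)"
  (is "?lhs \<longleftrightarrow> ?rhs")
proof
  assume ?lhs
  then obtain X G where X: "\<And>i. X i \<in> S" "\<And>i. GDERIV f (X i) :> G i" "X \<longlonglongrightarrow> x" "G \<longlonglongrightarrow> g"
    by blast
  show ?rhs
  proof (intro allI impI)
    fix e :: real assume "e > 0"
    have "\<forall>\<^sub>F i in sequentially. dist (X i) x < e \<and> dist (G i) g < e"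
      using X(3,4) \<open>e > 0\<close> by (intro eventually_conj tendstoD)
    then obtain i where "dist (X i) x < e \<and> dist (G i) g < e"
      by (auto simp: eventually_sequentially)
    then show "\<exists>y\<in>S. \<exists>h. (GDERIV f y :> h) \<and> dist y x < e \<and> dist h g < e"
      using X(1,2) by blast
  qed
next
  assume R: ?rhs
  have "\<forall>i::nat. \<exists>y h. y \<in> S \<and> (GDERIV f y :> h) \<and> dist y x < inverse (Suc i) \<and> dist h g < inverse (Suc i)"
    using R by (metis inverse_positive_iff_positive of_nat_0_less_iff zero_less_Suc)
  then obtain X G where X: "\<And>i::nat. X i \<in> S \<and> (GDERIV f (X i) :> G i) \<and>
      dist (X i) x < inverse (Suc i) \<and> dist (G i) g < inverse (Suc i)"
    by metis
  have "(\<lambda>i. dist (X i) x) \<longlonglongrightarrow> 0" "(\<lambda>i. dist (G i) g) \<longlonglongrightarrow> 0"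
    using X by (intro Lim_null_comparison[OF _ LIMSEQ_inverse_real_of_nat] always_eventually allI;
        force intro: less_imp_le)+
  then have "X \<longlonglongrightarrow> x" "G \<longlonglongrightarrow> g"
    using tendsto_dist_iff by blast+
  with X show ?lhs by blast
qed

text \<open>In the epsilon form the usual diagonal sequence becomes a triangle inequality through
  some \<open>g n\<close>.\<close>

lemma closed_limiting_gradients:
  "closed {g. \<exists>X G. (\<forall>i::nat. X i \<in> S \<and> (GDERIV f (X i) :> G i)) \<and> X \<longlonglongrightarrow> x \<and> G \<longlonglongrightarrow> g}"
  unfolding limiting_gradients_iff closed_sequential_limits
proof (intro allI impI, elim conjE, intro CollectI allI impI)
  fix g gl and e :: real
  assume g: "\<forall>n. g n \<in> {g. \<forall>e>0. \<exists>y\<in>S. \<exists>h. (GDERIV f y :> h) \<and> dist y x < e \<and> dist h g < e}"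
    and "g \<longlonglongrightarrow> gl" "e > 0"
  then obtain n where n: "dist (g n) gl < e/2"
    by (meson half_gt_zero lim_sequentially order_refl)
  obtain y h where "y \<in> S" "GDERIV f y :> h" "dist y x < e/2" "dist h (g n) < e/2"
    using g \<open>e > 0\<close> half_gt_zero by blast
  with n \<open>e > 0\<close> dist_triangle_half_r[of "g n" h e gl]
  show "\<exists>y\<in>S. \<exists>h. (GDERIV f y :> h) \<and> dist y x < e \<and> dist h gl < e"
    by (intro bexI[of _ y] exI[of _ h]) (auto simp: dist_commute)
qed

text \<open>The maximum is described by \<open>upper\<close> and \<open>attained\<close> instead of
  a supremum, so that \<open>f\<close> can be the ordered eigenvalue itself. Joint continuity lets
  the point and its maximiser vary together.\<close>

locale smooth_max =
  fixes S :: "'a::euclidean_space set" and K :: "'b::metric_space set"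
    and \<phi> :: "'a \<Rightarrow> 'b \<Rightarrow> real" and D :: "'a \<Rightarrow> 'b \<Rightarrow> 'a" and f :: "'a \<Rightarrow> real"
  assumes open_S: "open S" and compact_K: "compact K"
    and deriv: "\<And>y v. y \<in> S \<Longrightarrow> v \<in> K \<Longrightarrow> GDERIV (\<lambda>y. \<phi> y v) y :> D y v"
    and cont: "continuous_on (S \<times> K) (\<lambda>(y, v). \<phi> y v)"
    and cont_D: "continuous_on (S \<times> K) (\<lambda>(y, v). D y v)"
    and upper: "\<And>y v. y \<in> S \<Longrightarrow> v \<in> K \<Longrightarrow> \<phi> y v \<le> f y"
    and attained: "\<And>y. y \<in> S \<Longrightarrow> \<exists>v\<in>K. \<phi> y v = f y"
begin

lemma gradient_eq:
  assumes "y \<in> S" "v \<in> K" "\<phi> y v = f y" "GDERIV f y :> g"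
  shows "g = D y v"
  using GDERIV_touching[OF open_S assms(1) deriv[OF assms(1,2)] assms(4)] upper assms by simp

lemma tendsto_joint:
  assumes "continuous_on (S \<times> K) (\<lambda>(y, v). H y v)" "\<And>i. X i \<in> S" "\<And>i. w i \<in> K"
    "X \<longlonglongrightarrow> x" "w \<longlonglongrightarrow> v" "x \<in> S" "v \<in> K"
  shows "(\<lambda>i. H (X i) (w i)) \<longlonglongrightarrow> H x v"
proof -
  have "((\<lambda>i. (\<lambda>(y, v). H y v) (X i, w i)) \<longlonglongrightarrow> (\<lambda>(y, v). H y v) (x, v))"
    by (rule continuous_on_tendsto_compose[OF assms(1)]) (use assms in \<open>auto intro: tendsto_Pair\<close>)
  then show ?thesis by simp
qed

text \<open>Maximisers at the points \<open>X i\<close> subconverge in the compact \<open>K\<close>,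
  and by \<open>gradient_eq\<close> the gradients are the values of \<open>D\<close> there, so they
  subconverge as well.\<close>

lemma gradient_subsequence:
  assumes "x \<in> S" "\<And>i. X i \<in> S" "\<And>i. GDERIV f (X i) :> G i" "X \<longlonglongrightarrow> x"
  obtains v r where "v \<in> K" "\<phi> x v = f x" "strict_mono (r::nat\<Rightarrow>nat)" "(G \<circ> r) \<longlonglongrightarrow> D x v"
proof -
  obtain w where w: "\<And>i. w i \<in> K" "\<And>i. \<phi> (X i) (w i) = f (X i)"
  proof -
    have "\<forall>i. \<exists>u. u \<in> K \<and> \<phi> (X i) u = f (X i)"
      using attained assms(2) by blast
    then show ?thesis using that by metis
  qed
  obtain v r where v: "v \<in> K" "strict_mono (r::nat\<Rightarrow>nat)" "(w \<circ> r) \<longlonglongrightarrow> v"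
    using compact_K w(1) unfolding compact_def by metis
  have Xr: "(X \<circ> r) \<longlonglongrightarrow> x"
    using assms(4) v(2) LIMSEQ_subseq_LIMSEQ by blast
  have inr: "(X \<circ> r) i \<in> S" "(w \<circ> r) i \<in> K" for i using assms(2) w(1) by auto
  have "G i = D (X i) (w i)" for i
    using gradient_eq assms w by blast
  then have "(G \<circ> r) \<longlonglongrightarrow> D x v"
    using tendsto_joint[OF cont_D inr Xr v(3) \<open>x \<in> S\<close> \<open>v \<in> K\<close>] by (simp add: o_def)
  \<comment> \<open>Maximality survives the limit because each competitor \<open>u\<close> stays
    fixed along the sequence.\<close>
  moreover have "\<phi> x u \<le> \<phi> x v" if "u \<in> K" for u
  proof (rule LIMSEQ_le)
    show "(\<lambda>i. \<phi> ((X \<circ> r) i) ((w \<circ> r) i)) \<longlonglongrightarrow> \<phi> x v"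
      by (rule tendsto_joint[OF cont inr Xr v(3) \<open>x \<in> S\<close> \<open>v \<in> K\<close>])
    show "(\<lambda>i. \<phi> ((X \<circ> r) i) u) \<longlonglongrightarrow> \<phi> x u"
      by (rule tendsto_joint[OF cont inr(1) that Xr tendsto_const \<open>x \<in> S\<close> that])
    show "\<exists>N. \<forall>n\<ge>N. \<phi> ((X \<circ> r) n) u \<le> \<phi> ((X \<circ> r) n) ((w \<circ> r) n)"
      using w assms(2) upper that by auto
  qed
  then have "\<phi> x v = f x"
    using attained[OF \<open>x \<in> S\<close>] upper[OF \<open>x \<in> S\<close> \<open>v \<in> K\<close>] by fastforce
  ultimately show ?thesis using that v by blast
qed

text \<open>The bound on \<open>D\<close> over the compact \<open>cball x r \<times> K\<close> is
  uniform in \<open>v\<close>, and a maximum of functions with a common Lipschitz constant inherits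
  it: compare at the maximiser for \<open>y\<close>.\<close>

lemma lipschitz_near:
  assumes "x \<in> S"
  obtains r L where "r > 0" "L \<ge> 0" "cball x r \<subseteq> S"
    "\<And>y z. y \<in> cball x r \<Longrightarrow> z \<in> cball x r \<Longrightarrow> f y \<le> f z + L * norm (y - z)"
proof -
  obtain r where r: "r > 0" "cball x r \<subseteq> S"
    using assms open_S open_contains_cball by blast
  have "compact ((\<lambda>(y, v). D y v) ` (cball x r \<times> K))"
    by (intro compact_continuous_image continuous_on_subset[OF cont_D] compact_Times compact_K)
       (use r in auto)
  then have "bounded ((\<lambda>(y, v). D y v) ` (cball x r \<times> K))" by (rule compact_imp_bounded)
  then obtain L where L: "L > 0" "\<And>y v. y \<in> cball x r \<Longrightarrow> v \<in> K \<Longrightarrow> norm (D y v) \<le> L"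
    by (auto simp: bounded_pos simp del: mem_cball)
  have lip: "norm (\<phi> y v - \<phi> z v) \<le> L * norm (y - z)"
    if "y \<in> cball x r" "z \<in> cball x r" "v \<in> K" for y z v
  proof (rule differentiable_bound[OF convex_cball[of x r], where f' = "\<lambda>y h. h \<bullet> D y v"])
    fix u assume u: "u \<in> cball x r"
    show "((\<lambda>y. \<phi> y v) has_derivative (\<lambda>h. h \<bullet> D u v)) (at u within cball x r)"
      using deriv[of u v] u r that(3) has_derivative_at_withinI unfolding gderiv_def by blast
    show "onorm (\<lambda>h. h \<bullet> D u v) \<le> L"
    proof (rule onorm_le)
      fix h
      have "\<bar>h \<bullet> D u v\<bar> \<le> norm h * norm (D u v)" by (rule Cauchy_Schwarz_ineq2)
      also have "\<dots> \<le> norm h * L" using L(2)[OF u that(3)] by (simp add: mult_left_mono)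
      finally show "norm (h \<bullet> D u v) \<le> L * norm h" by (simp add: mult.commute)
    qed
  qed (use that in auto)
  have "f y \<le> f z + L * norm (y - z)" if "y \<in> cball x r" "z \<in> cball x r" for y z
  proof -
    have "y \<in> S" "z \<in> S" using that r by auto
    then obtain v where "v \<in> K" "\<phi> y v = f y" using attained by blast
    with lip[OF that \<open>v \<in> K\<close>] upper[OF \<open>z \<in> S\<close> \<open>v \<in> K\<close>] show ?thesis by auto
  qed
  with r L(1) show ?thesis using that by (meson less_imp_le)
qed

text \<open>In place of Rademacher's theorem: where \<open>f - \<psi>\<close> has a local maximum for a smooth \<open>\<psi>\<close>, the
  function \<open>f\<close> is squeezed between \<open>\<psi>\<close> and one of the \<open>\<phi>\<close>, hence differentiable there with
  the gradient of \<open>\<psi>\<close>. The quadratic \<open>\<psi>\<close> below has slope at least \<open>c\<close> in direction \<open>d\<close> on the half ball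
  \<open>0 \<le> d \<bullet> (z - x)\<close>, and its coefficients push the maximum into the interior of the half ball.\<close>

lemma steep_gradient_near:
  assumes x: "x \<in> S" and v: "v \<in> K" "\<phi> x v = f x"
    and d: "norm d = 1" and c: "c < d \<bullet> D x v" and \<delta>: "\<delta> > 0"
  obtains y g where "y \<in> S" "dist y x < \<delta>" "GDERIV f y :> g" "c \<le> d \<bullet> g"
proof -
  obtain r0 L where r0: "r0 > 0" "L \<ge> 0" "cball x r0 \<subseteq> S"
    and lip0: "\<And>y z. y \<in> cball x r0 \<Longrightarrow> z \<in> cball x r0 \<Longrightarrow> f y \<le> f z + L * norm (y - z)"
    using lipschitz_near[OF x] by metis
  define r where "r = min r0 \<delta>"
  have r: "r > 0" "cball x r \<subseteq> S" "r \<le> \<delta>" using r0 \<delta> by (auto simp: r_def)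
  have lip: "f y \<le> f z + L * norm (y - z)" if "y \<in> cball x r" "z \<in> cball x r" for y z
    using lip0 that by (auto simp: r_def)
  \<comment> \<open>On the rim at distance \<open>r\<close> from \<open>x\<close>, a quadratic term
    \<open>M * r^2 = (L + \<bar>c\<bar>) * r\<close> outweighs both the Lipschitz growth of
    \<open>f\<close> and a negative linear term. This excludes a maximum on the rim.\<close>
  define M where "M = (L + \<bar>c\<bar>) / r"
  have M: "M \<ge> 0" "M * r = L + \<bar>c\<bar>" using r r0 by (auto simp: M_def)
  have dd: "d \<bullet> d = 1" using d by (simp add: dot_square_norm)
  \<comment> \<open>The slope of \<open>\<phi>\<close> along \<open>d\<close> exceeds
    \<open>c\<close> strictly, and \<open>M\<close> enters only to second order, so a short step
    along \<open>d\<close> gains however large \<open>M\<close> is.\<close>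
  obtain s where s: "s > 0" "s < r" and \<eta>: "f (x + s *\<^sub>R d) - c * s - M * s^2 > f x"
  proof -
    have "((\<lambda>y. \<phi> y v) has_derivative (\<lambda>h. h \<bullet> D x v)) (at (x + 0 *\<^sub>R d))"
      using deriv[OF x v(1)] by (simp add: gderiv_def)
    then have "((\<lambda>s. \<phi> (x + s *\<^sub>R d) v) has_derivative (\<lambda>s. (s *\<^sub>R d) \<bullet> D x v)) (at 0)"
      by (rule has_derivative_compose[rotated]) (auto intro!: derivative_eq_intros)
    then have "((\<lambda>s. \<phi> (x + s *\<^sub>R d) v) has_real_derivative (d \<bullet> D x v)) (at 0)"
      by (simp add: has_field_derivative_def mult_commute_abs)
    then have "((\<lambda>s. \<phi> (x + s *\<^sub>R d) v - c * s - M * s^2) has_real_derivative (d \<bullet> D x v - c)) (at 0)"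
      by (auto intro!: derivative_eq_intros)
    from DERIV_pos_inc_right[OF this] c obtain e where "e > 0"
      and e: "\<And>h. h > 0 \<Longrightarrow> h < e \<Longrightarrow> f x < \<phi> (x + h *\<^sub>R d) v - c * h - M * h^2"
      using v by auto
    define s where "s = min (e/2) (r/2)"
    have s: "s > 0" "s < e" "s < r" using \<open>e > 0\<close> r by (auto simp: s_def)
    have "x + s *\<^sub>R d \<in> cball x r" using s d by (auto simp: dist_norm)
    then have "\<phi> (x + s *\<^sub>R d) v \<le> f (x + s *\<^sub>R d)" using r v upper by blast
    with e[of s] s that show ?thesis by force
  qed
  define \<eta> where "\<eta> = f (x + s *\<^sub>R d) - c * s - M * s^2 - f x"
  have "\<eta> > 0" using \<eta> by (simp add: \<eta>_def)
  \<comment> \<open>On the flat face \<open>d \<bullet> (z - x) = 0\<close> the gain is at most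
    \<open>L * w - N * w^2 \<le> L^2 / (4 * N)\<close> with \<open>w = norm (z - x)\<close>. This
    \<open>N\<close> makes it smaller than \<open>\<eta>\<close>, which excludes a maximum
    there.\<close>
  define N where "N = M + 1 + L^2 / \<eta>"
  have N: "N \<ge> M" "N > 0" "L^2 < 4 * N * \<eta>"
  proof -
    have q: "0 \<le> L^2 / \<eta>" using \<open>\<eta> > 0\<close> by simp
    then show "N \<ge> M" "N > 0" using M by (auto simp: N_def)
    have "4 * N * \<eta> = 4 * (M + 1) * \<eta> + 4 * L^2"
      using \<open>\<eta> > 0\<close> by (simp add: N_def field_simps)
    moreover have "4 * (M + 1) * \<eta> > 0" using M \<open>\<eta> > 0\<close> by simp
    ultimately show "L^2 < 4 * N * \<eta>" using zero_le_power2[of L] by linarith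
  qed
  \<comment> \<open>That is, \<open>M\<close> weights the square of the component along
    \<open>d\<close> and \<open>N\<close> that of the orthogonal part. Hence \<open>N\<close> has no
    effect on the axis through \<open>x\<close>, and the gain \<open>\<eta>\<close> could be fixed
    before \<open>N\<close>.\<close>
  define \<psi> where "\<psi> z = c * (d \<bullet> (z - x)) + (M - N) * (d \<bullet> (z - x))^2 + N * ((z - x) \<bullet> (z - x))" for z
  define C where "C = cball x r \<inter> {z. 0 \<le> d \<bullet> (z - x)}"
  have "compact C"
    unfolding C_def by (intro compact_Int_closed compact_cball closed_Collect_le continuous_intros)
  have xs: "x + s *\<^sub>R d \<in> C" using s d dd by (auto simp: C_def dist_norm)
  have xr: "x \<in> cball x r" using r by simp
  have "continuous_on (cball x r) f"
  proof (rule continuous_onI)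
    fix y and e :: real assume y: "y \<in> cball x r" "e > 0"
    show "\<exists>t>0. \<forall>z\<in>cball x r. dist z y < t \<longrightarrow> dist (f z) (f y) \<le> e"
    proof (intro exI[of _ "e / (L + 1)"] conjI ballI impI)
      show "e / (L + 1) > 0" using y r0 by simp
      fix z assume z: "z \<in> cball x r" "dist z y < e / (L + 1)"
      have "dist (f z) (f y) \<le> L * dist z y"
        using lip[OF y(1) z(1)] lip[OF z(1) y(1)]
        by (auto simp: dist_norm norm_minus_commute abs_le_iff)
      also have "\<dots> \<le> (L + 1) * dist z y" by (simp add: mult_right_mono)
      also have "\<dots> \<le> e" using z r0 by (simp add: field_simps)
      finally show "dist (f z) (f y) \<le> e" .
    qed
  qed
  then have "continuous_on C (\<lambda>z. f z - \<psi> z)"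
    unfolding \<psi>_def C_def by (intro continuous_intros) (auto intro: continuous_on_subset)
  then obtain y where y: "y \<in> C" and ymax: "\<And>z. z \<in> C \<Longrightarrow> f z - \<psi> z \<le> f y - \<psi> y"
    using continuous_attains_sup[OF \<open>compact C\<close>] xs by blast
  have "f (x + s *\<^sub>R d) - \<psi> (x + s *\<^sub>R d) = f x + \<eta>"
    using dd by (simp add: \<psi>_def \<eta>_def power2_eq_square algebra_simps)
  with ymax[OF xs] have big: "f x + \<eta> \<le> f y - \<psi> y" by simp
  have yr: "y \<in> cball x r" and y0: "0 \<le> d \<bullet> (y - x)" using y by (auto simp: C_def)
  have fy: "f y \<le> f x + L * norm (y - x)" using lip[OF yr xr] .
  define a where "a = d \<bullet> (y - x)"
  define w where "w = norm (y - x)"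
  have aw: "\<bar>a\<bar> \<le> w" using Cauchy_Schwarz_ineq2[of d "y - x"] d by (simp add: a_def w_def)
  have \<psi>y: "\<psi> y = c * a + (M - N) * a^2 + N * w^2"
    by (simp add: \<psi>_def a_def w_def dot_square_norm)
  have "a^2 \<le> w^2" using aw by (simp add: abs_le_square_iff[symmetric] w_def)
  have "w < r"
  proof (rule ccontr)
    assume "\<not> w < r"
    then have w: "w = r" using yr by (simp add: w_def dist_norm norm_minus_commute)
    have "(N - M) * a^2 \<le> (N - M) * w^2"
      using N \<open>a^2 \<le> w^2\<close> by (intro mult_left_mono) auto
    then have "\<psi> y \<ge> c * a + M * w^2" by (simp add: \<psi>y algebra_simps)
    moreover have "c * a \<ge> - (\<bar>c\<bar> * w)"
      using mult_left_mono[OF aw, of "\<bar>c\<bar>"] abs_mult[of c a] by (simp add: abs_le_iff)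
    moreover have "M * w^2 = (L + \<bar>c\<bar>) * w"
      using M w by (simp add: power2_eq_square mult.assoc[symmetric])
    ultimately have "\<psi> y \<ge> L * w" by (simp add: algebra_simps)
    then show False using fy big \<open>\<eta> > 0\<close> by (simp add: w_def)
  qed
  have "a > 0"
  proof (rule ccontr)
    assume "\<not> a > 0"
    then have "a = 0" using y0 by (simp add: a_def)
    then have "f x + \<eta> \<le> f x + L * w - N * w^2" using big fy \<psi>y by (simp add: w_def)
    then have "4 * N * \<eta> \<le> 4 * N * (L * w - N * w^2)" using N by (intro mult_left_mono) auto
    also have "\<dots> = L^2 - (L - 2 * N * w)^2" by (simp add: power2_eq_square algebra_simps)
    also have "\<dots> \<le> L^2" by simp
    finally show False using N by simp
  qed
  define g where "g = (c + 2 * (M - N) * a) *\<^sub>R d + (2 * N) *\<^sub>R (y - x)"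
  have psi': "GDERIV \<psi> y :> g"
    unfolding gderiv_def \<psi>_def
    by (rule derivative_eq_intros refl)+
      (simp add: fun_eq_iff g_def a_def inner_add_right inner_commute algebra_simps)
  define T where "T = ball x r \<inter> {z. 0 < d \<bullet> (z - x)}"
  have T: "open T" "T \<subseteq> C" "T \<subseteq> S" "y \<in> T"
    using r \<open>a > 0\<close> \<open>w < r\<close> unfolding T_def
    by (auto intro!: open_Int open_Collect_less continuous_intros
        simp: C_def a_def w_def dist_norm norm_minus_commute)
  then have "y \<in> S" by blast
  then obtain u where u: "u \<in> K" "\<phi> y u = f y" using attained by blast
  have "GDERIV f y :> g"
  proof (rule GDERIV_sandwich[OF T(1,4) deriv[OF \<open>y \<in> S\<close> u(1)]])
    show "GDERIV (\<lambda>z. \<psi> z + (f y - \<psi> y)) y :> g"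
      using GDERIV_add[OF psi' GDERIV_const] by simp
    show "\<phi> z u \<le> f z" "f z \<le> \<psi> z + (f y - \<psi> y)" if "z \<in> T" for z
      using that T upper u ymax[of z] by auto
  qed (use u in auto)
  moreover have "d \<bullet> g = c + 2 * M * a"
    using dd by (simp add: g_def a_def inner_add_right algebra_simps)
  moreover have "0 \<le> 2 * M * a" using M \<open>a > 0\<close> by simp
  moreover have "dist y x < \<delta>" using \<open>w < r\<close> r by (simp add: w_def dist_norm)
  ultimately show ?thesis using that[of y g] \<open>y \<in> S\<close> by simp
qed

lemma clarke_subdiff_eq:
  assumes x: "x \<in> S"
  shows "clarke_subdiff S f x = convex hull {D x v | v. v \<in> K \<and> \<phi> x v = f x}"
proof -
  define R where "R = {g. \<exists>X G. (\<forall>i::nat. X i \<in> S \<and> (GDERIV f (X i) :> G i)) \<and> X \<longlonglongrightarrow> x \<and> G \<longlonglongrightarrow> g}"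
  define Q where "Q = {D x v | v. v \<in> K \<and> \<phi> x v = f x}"
  have RQ: "R \<subseteq> Q"
  proof
    fix g assume "g \<in> R"
    then obtain X G where XG: "\<forall>i::nat. X i \<in> S \<and> (GDERIV f (X i) :> G i)" and X: "X \<longlonglongrightarrow> x" "G \<longlonglongrightarrow> g"
      unfolding R_def mem_Collect_eq by (elim exE conjE)
    obtain v r where v: "v \<in> K" "\<phi> x v = f x" "strict_mono (r::nat\<Rightarrow>nat)" "(G \<circ> r) \<longlonglongrightarrow> D x v"
      using gradient_subsequence[of x X G] x XG X(1) by metis
    then have "g = D x v"
      using LIMSEQ_unique[OF LIMSEQ_subseq_LIMSEQ[OF X(2) v(3)] v(4)] by simp
    with v show "g \<in> Q" unfolding Q_def by blast
  qed
  \<comment> \<open>Slopes strictly below \<open>d \<bullet> D x v\<close> are reached arbitrarily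
    near \<open>x\<close>. A limit of such gradients reaches the slope itself, although it may
    differ from \<open>D x v\<close>.\<close>
  have steep: "\<exists>g\<in>R. d \<bullet> D x v \<le> d \<bullet> g" if d: "norm d = 1" and v: "v \<in> K" "\<phi> x v = f x" for d v
  proof -
    have "\<exists>y g. y \<in> S \<and> dist y x < inverse (Suc i) \<and> (GDERIV f y :> g) \<and> d \<bullet> D x v - inverse (Suc i) \<le> d \<bullet> g"
      for i :: nat
      using steep_gradient_near[OF x v d, of "d \<bullet> D x v - inverse (Suc i)" "inverse (Suc i)"] by force
    then obtain X G where X: "\<And>i::nat. X i \<in> S" "\<And>i. dist (X i) x < inverse (Suc i)"
      "\<And>i. GDERIV f (X i) :> G i" "\<And>i. d \<bullet> D x v - inverse (Suc i) \<le> d \<bullet> G i"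
      by metis
    have "(\<lambda>i. dist (X i) x) \<longlonglongrightarrow> 0"
      using X(2) by (intro Lim_null_comparison[OF _ LIMSEQ_inverse_real_of_nat] always_eventually allI)
        (auto intro: less_imp_le)
    then have lim: "X \<longlonglongrightarrow> x" using tendsto_dist_iff by blast
    obtain u r where u: "u \<in> K" "strict_mono (r::nat\<Rightarrow>nat)" "(G \<circ> r) \<longlonglongrightarrow> D x u"
      using gradient_subsequence[OF x X(1,3) lim] by metis
    have "D x u \<in> R"
      unfolding R_def using X u(3) LIMSEQ_subseq_LIMSEQ[OF lim u(2)]
      by (intro CollectI exI[of _ "X \<circ> r"] exI[of _ "G \<circ> r"]) auto
    moreover have "d \<bullet> D x v \<le> d \<bullet> D x u"
    proof (rule LIMSEQ_le)
      have "(\<lambda>i. d \<bullet> D x v - inverse (Suc i)) \<longlonglongrightarrow> d \<bullet> D x v - 0"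
        by (intro tendsto_intros LIMSEQ_inverse_real_of_nat)
      from LIMSEQ_subseq_LIMSEQ[OF this u(2)]
      show "(\<lambda>i. d \<bullet> D x v - inverse (Suc (r i))) \<longlonglongrightarrow> d \<bullet> D x v" by (simp add: o_def)
      show "(\<lambda>i. d \<bullet> (G \<circ> r) i) \<longlonglongrightarrow> d \<bullet> D x u" using u(3) by (intro tendsto_intros)
      show "\<exists>N. \<forall>n\<ge>N. d \<bullet> D x v - inverse (Suc (r n)) \<le> d \<bullet> (G \<circ> r) n"
        using X(4) by auto
    qed
    ultimately show ?thesis by blast
  qed
  \<comment> \<open>Compactness of \<open>R\<close> makes its convex hull closed, as strict
    separation requires.\<close>
  have "compact ((\<lambda>(y, v). D y v) ` ({x} \<times> K))"
    by (intro compact_continuous_image continuous_on_subset[OF cont_D] compact_Times compact_K)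
       (use x in auto)
  then have "bounded R"
    by (rule bounded_subset[OF compact_imp_bounded]) (use RQ in \<open>auto simp: Q_def\<close>)
  then have "compact R"
    using closed_limiting_gradients[of S f x] unfolding R_def by (simp add: compact_eq_bounded_closed)
  then have "compact (convex hull R)" by (rule compact_convex_hull)
  have "Q \<subseteq> convex hull R"
  proof (rule ccontr)
    assume "\<not> Q \<subseteq> convex hull R"
    then obtain v where v: "v \<in> K" "\<phi> x v = f x" and "D x v \<notin> convex hull R"
      unfolding Q_def by blast
    then obtain d b where d: "d \<bullet> D x v < b" "\<And>g. g \<in> convex hull R \<Longrightarrow> d \<bullet> g > b"
      using separating_hyperplane_closed_point[OF convex_convex_hull compact_imp_closed[OF \<open>compact (convex hull R)\<close>]]
      by metis
    \<comment> \<open>For empty \<open>R\<close> the separating \<open>d\<close> could be 0; one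
      limiting gradient rules this out.\<close>
    obtain e :: 'a where "norm e = 1" using vector_choose_size[of 1] by auto
    then obtain g0 where "g0 \<in> R" using steep v by blast
    then have "d \<noteq> 0" using d hull_inc[of g0 R convex] by force
    \<comment> \<open>The hull lies above the hyperplane, so the direction to test is
      \<open>- d\<close>.\<close>
    then have "norm (- (d /\<^sub>R norm d)) = 1" by simp
    from steep[OF this v] obtain g where "g \<in> R" "- (d /\<^sub>R norm d) \<bullet> D x v \<le> - (d /\<^sub>R norm d) \<bullet> g"
      by blast
    then have "d \<bullet> g \<le> d \<bullet> D x v" using \<open>d \<noteq> 0\<close> by (simp add: divide_simps)
    with d hull_inc[OF \<open>g \<in> R\<close>, of convex] show False by force
  qed
  then have "convex hull Q \<subseteq> convex hull R" by (simp add: hull_minimal)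
  moreover have "convex hull R \<subseteq> convex hull Q" using RQ by (rule hull_mono)
  ultimately show ?thesis
    unfolding clarke_subdiff_def R_def Q_def by blast
qed

end

section \<open>Positive semidefinite matrices and the spectraplex\<close>

lemma sym_mat_inner: "sym_mat X \<Longrightarrow> (X *v u) \<bullet> v = u \<bullet> (X *v v)"
  for X :: "real^'n^'n"
  by (metis dot_lmul_matrix sym_mat_def vector_transpose_matrix)

text \<open>The form may be degenerate: if \<open>c = 0\<close>, the nonnegative polynomial is
  affine in \<open>q\<close>, which forces \<open>b = 0\<close>.\<close>

lemma pos_semidef_Cauchy_Schwarz:
  fixes M :: "real^'n^'n"
  assumes "pos_semidef M"
  shows "(u \<bullet> (M *v v))\<^sup>2 \<le> (u \<bullet> (M *v u)) * (v \<bullet> (M *v v))"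
proof -
  define a b c where "a = u \<bullet> (M *v u)" and "b = u \<bullet> (M *v v)" and "c = v \<bullet> (M *v v)"
  have M: "sym_mat M" "\<And>w. 0 \<le> w \<bullet> (M *v w)" using assms by (auto simp: pos_semidef_def)
  have sym: "v \<bullet> (M *v u) = b" using sym_mat_inner[OF M(1), of u v] by (simp add: b_def inner_commute)
  have "0 \<le> (p *\<^sub>R u + q *\<^sub>R v) \<bullet> (M *v (p *\<^sub>R u + q *\<^sub>R v))" for p q by (rule M)
  also have "(p *\<^sub>R u + q *\<^sub>R v) \<bullet> (M *v (p *\<^sub>R u + q *\<^sub>R v)) = p^2 * a + 2 * p * q * b + q^2 * c" for p q
    using sym by (simp add: a_def b_def c_def matrix_vector_right_distrib matrix_vector_mult_scaleR
        inner_add_left inner_add_right power2_eq_square algebra_simps)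
  finally have quad: "0 \<le> p^2 * a + 2 * p * q * b + q^2 * c" for p q .
  have ac: "a \<ge> 0" "c \<ge> 0" using M by (auto simp: a_def c_def)
  show ?thesis
  proof (cases "c = 0")
    case True
    have "0 \<le> a + 2 * q * b" for q using quad[of 1 q] True by simp
    \<comment> \<open>For \<open>b \<noteq> 0\<close> this \<open>q\<close> gives the value
      \<open>- a - 2\<close>, which is negative.\<close>
    from this[of "- (a + 1) / b"] have "b = 0" using ac by (cases "b = 0") auto
    then show ?thesis using True by (simp add: b_def c_def)
  next
    case False
    then have "c > 0" using ac by simp
    have "0 \<le> c * (a * c - b^2)"
      using quad[of c "-b"] by (simp add: power2_eq_square algebra_simps)
    then have "b^2 \<le> a * c" using \<open>c > 0\<close> by (simp add: zero_le_mult_iff)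
    then show ?thesis by (simp add: a_def b_def c_def)
  qed
qed

text \<open>Cauchy-Schwarz with \<open>u = M *v v\<close>. This turns equality in a variational
  inequality into an eigenvector equation.\<close>

lemma pos_semidef_mult_eq_0:
  fixes M :: "real^'n^'n"
  assumes "pos_semidef M" "v \<bullet> (M *v v) = 0"
  shows "M *v v = 0"
  using pos_semidef_Cauchy_Schwarz[OF assms(1), of "M *v v" v] assms(2) by simp

section \<open>Rank one matrices and the trace inner product\<close>

definition outer :: "real^'n \<Rightarrow> real^'n^'n" where
  "outer u = (\<chi> i j. u $ i * u $ j)"

lemma outer_mult: "outer u *v w = (u \<bullet> w) *\<^sub>R u"
  by (simp add: outer_def matrix_vector_mult_def vec_eq_iff inner_vec_def sum_distrib_left mult_ac)

lemma trace_outer: "trace (outer u) = u \<bullet> u"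
  by (simp add: trace_def outer_def inner_vec_def)

lemma mat_inner_add_left: "mat_inner (X + Y) W = mat_inner X W + mat_inner Y W"
  by (simp add: mat_inner_def trace_def matrix_matrix_mult_def sum.distrib distrib_right)

lemma mat_inner_scaleR_left: "mat_inner (c *\<^sub>R X) W = c * mat_inner X W"
  by (simp add: mat_inner_def trace_def matrix_matrix_mult_def sum_distrib_left mult_ac)

lemma mat_inner_outer: "mat_inner (outer u) W = u \<bullet> (W *v u)"
proof -
  have "mat_inner (outer u) W = (\<Sum>i\<in>UNIV. \<Sum>j\<in>UNIV. u $ i * u $ j * W $ j $ i)"
    by (simp add: mat_inner_def trace_def matrix_matrix_mult_def outer_def)
  also have "\<dots> = (\<Sum>j\<in>UNIV. \<Sum>i\<in>UNIV. u $ i * u $ j * W $ j $ i)" by (rule sum.swap)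
  also have "\<dots> = u \<bullet> (W *v u)"
    by (simp add: inner_vec_def matrix_vector_mult_def sum_distrib_left mult_ac)
  finally show ?thesis .
qed

lemma outer_scaleR: "outer (c *\<^sub>R u) = c\<^sup>2 *\<^sub>R outer u"
  by (simp add: outer_def vec_eq_iff power2_eq_square mult_ac)

lemma sym_mat_outer: "sym_mat (outer u)"
  by (simp add: sym_mat_def outer_def transpose_def mult.commute)

lemma sym_mat_diff: "sym_mat X \<Longrightarrow> sym_mat Y \<Longrightarrow> sym_mat (X - Y)"
  by (auto simp: sym_mat_def transpose_def vec_eq_iff)

lemma sym_mat_scaleR: "sym_mat X \<Longrightarrow> sym_mat (c *\<^sub>R X)"
  by (auto simp: sym_mat_def transpose_def vec_eq_iff)

lemma pos_semidef_outer: "pos_semidef (outer u)"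
  by (simp add: pos_semidef_def sym_mat_outer outer_mult inner_commute)

text \<open>Takes the place of a spectral decomposition: as in a Cholesky step, a rank one piece is
  split off so that the rest stays positive semidefinite and its kernel grows. The induction is on
  the rank.\<close>

lemma pos_semidef_induct [consumes 1, case_names zero add_outer]:
  fixes U :: "real^'n^'n"
  assumes "pos_semidef U"
    and zero: "P 0" and add: "\<And>U u. pos_semidef U \<Longrightarrow> P U \<Longrightarrow> P (U + outer u)"
  shows "P U"
  using assms(1)
proof (induction "CARD('n) - dim {w. U *v w = 0}" arbitrary: U rule: less_induct)
  case less
  have U: "sym_mat U" "\<And>w. 0 \<le> w \<bullet> (U *v w)" using less.prems by (auto simp: pos_semidef_def)
  show ?case
  proof (cases "\<exists>v. v \<bullet> (U *v v) \<noteq> 0")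
    case False
    then have "U *v v = 0" for v using pos_semidef_mult_eq_0[OF less.prems] by blast
    then have "U = 0" by (simp add: matrix_eq)
    then show ?thesis using zero by simp
  next
    case True
    then obtain v where "v \<bullet> (U *v v) \<noteq> 0" by blast
    define c where "c = v \<bullet> (U *v v)"
    have c: "c > 0" using U(2)[of v] \<open>v \<bullet> (U *v v) \<noteq> 0\<close> by (simp add: c_def)
    \<comment> \<open>Scaled so that subtracting \<open>outer u\<close> sends \<open>v\<close> to 0;
      Cauchy-Schwarz then says exactly that the rest is positive semidefinite.\<close>
    define u where "u = (1 / sqrt c) *\<^sub>R (U *v v)"
    define U' where "U' = U - outer u"
    have U'w: "U' *v w = U *v w - (((U *v v) \<bullet> w) / c) *\<^sub>R (U *v v)" for w
      using c by (simp add: U'_def u_def outer_mult matrix_vector_mult_diff_rdistrib)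
    have psd: "pos_semidef U'"
      unfolding pos_semidef_def
    proof (intro conjI allI)
      show "sym_mat U'" using U sym_mat_outer sym_mat_diff by (auto simp: U'_def)
      fix w
      have "(w \<bullet> (U *v v))\<^sup>2 \<le> (w \<bullet> (U *v w)) * c"
        using pos_semidef_Cauchy_Schwarz[OF less.prems] by (simp add: c_def)
      then have "(w \<bullet> (U *v v))\<^sup>2 / c \<le> w \<bullet> (U *v w)" using c by (simp add: divide_le_eq)
      then show "0 \<le> w \<bullet> (U' *v w)"
        by (simp add: U'w inner_diff_right power2_eq_square inner_commute)
    qed
    have sub: "subspace {w. M *v w = 0}" for M :: "real^'n^'n"
      by (auto simp: subspace_def matrix_vector_right_distrib matrix_vector_mult_scaleR)
    have "{w. U *v w = 0} \<subset> {w. U' *v w = 0}"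
    proof
      show "{w. U *v w = 0} \<subseteq> {w. U' *v w = 0}"
        using sym_mat_inner[OF U(1)] by (auto simp: U'w)
      have "U' *v v = 0" using c by (simp add: U'w c_def inner_commute)
      moreover have "U *v v \<noteq> 0" using c by (auto simp: c_def)
      ultimately show "{w. U *v w = 0} \<noteq> {w. U' *v w = 0}" by blast
    qed
    then have "dim {w. U *v w = 0} < dim {w. U' *v w = 0}"
      by (intro dim_psubset) (simp add: span_eq_iff[THEN iffD2, OF sub])
    moreover have "dim {w. U' *v w = 0} \<le> CARD('n)" by (rule dim_subset_UNIV_cart)
    ultimately have "P U'" by (intro less.hyps psd) simp
    from add[OF psd this, of u] show ?thesis by (simp add: U'_def)
  qed
qed

lemma spectraplex_eq_hull: "spectraplex = convex hull (outer ` {u. norm u = 1})"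
proof
  show "convex hull (outer ` {u. norm u = 1}) \<subseteq> (spectraplex :: (real^'n^'n) set)"
  proof (rule hull_minimal)
    show "outer ` {u. norm u = 1} \<subseteq> (spectraplex :: (real^'n^'n) set)"
      by (auto simp: spectraplex_def pos_semidef_outer trace_outer dot_square_norm)
    show "convex (spectraplex :: (real^'n^'n) set)"
      unfolding convex_def spectraplex_def pos_semidef_def sym_mat_def
      by (auto simp: matrix_vector_mult_add_rdistrib scaleR_matrix_vector_assoc[symmetric] inner_add_right
          trace_def sum.distrib sum_distrib_left[symmetric] transpose_def vec_eq_iff)
  qed
next
  let ?H = "convex hull (outer ` {u. norm u = 1}) :: (real^'n^'n) set"
  \<comment> \<open>Multiplying \<open>Z\<close> by the trace instead of dividing \<open>U\<close>
    by it covers the zero matrix, for which any point of the hull serves.\<close>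
  have "0 \<le> trace U \<and> (\<exists>Z\<in>?H. U = trace U *\<^sub>R Z)" if "pos_semidef U" for U :: "real^'n^'n"
    using that
  proof (induction rule: pos_semidef_induct)
    case zero
    obtain e :: "real^'n" where "norm e = 1" using vector_choose_size[of 1] by auto
    then have "outer e \<in> ?H" by (intro hull_inc) auto
    then show ?case by (auto simp: trace_def)
  next
    case (add_outer U u)
    then obtain Z where Z: "0 \<le> trace U" "Z \<in> ?H" "U = trace U *\<^sub>R Z" by blast
    have tr: "trace (U + outer u) = trace U + u \<bullet> u" by (simp add: trace_add trace_outer)
    show ?case
    proof (cases "u = 0")
      case True
      then have "outer u = 0" by (simp add: outer_def vec_eq_iff)
      with add_outer show ?thesis by simp
    next
      case False
      then have pos: "u \<bullet> u > 0" by simp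
      define s where "s = trace U + u \<bullet> u"
      have s: "s > 0" unfolding s_def using Z(1) pos by (rule add_nonneg_pos)
      define Y where "Y = outer (u /\<^sub>R norm u)"
      have "Y \<in> ?H" unfolding Y_def using False by (intro hull_inc) auto
      have uY: "outer u = (u \<bullet> u) *\<^sub>R Y"
        using False by (simp add: Y_def outer_scaleR dot_square_norm power_inverse)
      have "trace U / s + u \<bullet> u / s = 1"
        unfolding add_divide_distrib[symmetric] s_def[symmetric] using s by simp
      then have "(trace U / s) *\<^sub>R Z + (u \<bullet> u / s) *\<^sub>R Y \<in> ?H"
        using Z \<open>Y \<in> ?H\<close> s pos
        by (intro convexD[OF convex_convex_hull]) auto
      moreover have "U + outer u = s *\<^sub>R ((trace U / s) *\<^sub>R Z + (u \<bullet> u / s) *\<^sub>R Y)"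
        using s Z(3) uY by (simp add: scaleR_add_right)
      ultimately show ?thesis using s tr by (auto simp: s_def)
    qed
  qed
  then show "(spectraplex :: (real^'n^'n) set) \<subseteq> ?H"
    by (fastforce simp: spectraplex_def)
qed

section \<open>The maximum generalized eigenvalue\<close>

text \<open>At \<open>v = 0\<close> the value is 0 by division by zero, which could exceed a
  negative maximum; hence the restriction to nonzero vectors in the bounds below.\<close>

abbreviation rayleigh :: "real^'n^'n \<Rightarrow> real^'n^'n \<Rightarrow> real^'n \<Rightarrow> real" where
  "rayleigh X Y v \<equiv> (v \<bullet> (X *v v)) / (v \<bullet> (Y *v v))"

lemma continuous_on_quadratic_form [continuous_intros]:
  fixes M :: "'a::topological_space \<Rightarrow> real^'n^'n"
  assumes "continuous_on T M" "continuous_on T w"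
  shows "continuous_on T (\<lambda>z. w z \<bullet> (M z *v w z))"
  unfolding matrix_vector_mult_def
  by (intro continuous_intros continuous_on_vec_lambda continuous_on_component assms)

lemma pos_def_quadratic_form_pos: "pos_def Y \<Longrightarrow> v \<noteq> 0 \<Longrightarrow> 0 < v \<bullet> (Y *v v)"
  by (simp add: pos_def_def)

lemma rayleigh_scaleR: "c \<noteq> 0 \<Longrightarrow> rayleigh X Y (c *\<^sub>R v) = rayleigh X Y v"
  by (simp add: matrix_vector_mult_scaleR)

lemma rayleigh_gen_eigenvector:
  assumes "pos_def Y" "is_gen_eigenvector X Y \<mu> v"
  shows "rayleigh X Y v = \<mu>"
  using assms pos_def_quadratic_form_pos[of Y v] by (simp add: is_gen_eigenvector_def)

text \<open>Maximality says that \<open>\<mu> *\<^sub>R Y - X\<close> is positive semidefinite with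
  a form vanishing at \<open>v\<close>, so \<open>v\<close> lies in its kernel.\<close>

lemma gen_eigenvector_rayleigh_max:
  assumes "sym_mat X" "pos_def Y" "v \<noteq> 0" and max: "\<And>w. w \<noteq> 0 \<Longrightarrow> rayleigh X Y w \<le> rayleigh X Y v"
  shows "is_gen_eigenvector X Y (rayleigh X Y v) v"
proof -
  define \<mu> where "\<mu> = rayleigh X Y v"
  define M where "M = \<mu> *\<^sub>R Y - X"
  have Mw: "M *v w = \<mu> *\<^sub>R (Y *v w) - X *v w" for w
    by (simp add: M_def matrix_vector_mult_diff_rdistrib scaleR_matrix_vector_assoc[symmetric])
  have "pos_semidef M"
    unfolding pos_semidef_def
  proof (intro conjI allI)
    show "sym_mat M"
      using assms(1,2) by (auto simp: M_def pos_def_def intro: sym_mat_diff sym_mat_scaleR)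
    show "0 \<le> w \<bullet> (M *v w)" for w
    proof (cases "w = 0")
      case False
      then have "w \<bullet> (X *v w) \<le> \<mu> * (w \<bullet> (Y *v w))"
        using max[OF False] pos_def_quadratic_form_pos[OF assms(2) False]
        by (simp add: \<mu>_def[symmetric] pos_divide_le_eq)
      then show ?thesis by (simp add: Mw inner_diff_right)
    qed simp
  qed
  moreover have "v \<bullet> (M *v v) = 0"
    using pos_def_quadratic_form_pos[OF assms(2,3)] by (simp add: Mw inner_diff_right \<mu>_def)
  ultimately have "M *v v = 0" by (rule pos_semidef_mult_eq_0)
  then show ?thesis using assms(3) by (simp add: Mw is_gen_eigenvector_def \<mu>_def)
qed

lemma rayleigh_max_exists:
  fixes X Y :: "real^'n^'n"
  assumes "pos_def Y"
  obtains v where "norm v = 1" "\<And>w. w \<noteq> 0 \<Longrightarrow> rayleigh X Y w \<le> rayleigh X Y v"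
proof -
  obtain e :: "real^'n" where e: "norm e = 1" using vector_choose_size[of 1] by auto
  have "continuous_on (sphere 0 1) (rayleigh X Y)"
  proof (intro continuous_intros ballI)
    fix v :: "real^'n" assume "v \<in> sphere 0 1"
    then have "v \<noteq> 0" by auto
    then show "v \<bullet> (Y *v v) \<noteq> 0" using pos_def_quadratic_form_pos[OF assms, of v] by simp
  qed
  moreover have "e \<in> sphere 0 1" using e by simp
  ultimately have "\<exists>v\<in>sphere 0 1. \<forall>w\<in>sphere 0 1. rayleigh X Y w \<le> rayleigh X Y v"
    by (intro continuous_attains_sup compact_sphere) auto
  then obtain v where v: "v \<in> sphere 0 1" "\<And>w. w \<in> sphere 0 1 \<Longrightarrow> rayleigh X Y w \<le> rayleigh X Y v"
    by blast
  show ?thesis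
  proof (rule that)
    show "norm v = 1" using v by simp
    show "rayleigh X Y w \<le> rayleigh X Y v" if "w \<noteq> 0" for w
      using v(2)[of "w /\<^sub>R norm w"] that rayleigh_scaleR[of "inverse (norm w)" w X Y] by simp
  qed
qed

section \<open>Spectrum, ordering and multiplicity\<close>

lemma gen_eigenvectors_orthogonal:
  assumes "sym_mat X" "pos_def Y" "is_gen_eigenvector X Y \<mu> v" "is_gen_eigenvector X Y \<nu> w" "\<mu> \<noteq> \<nu>"
  shows "(Y *v v) \<bullet> w = 0"
proof -
  have Y: "sym_mat Y" using assms(2) by (simp add: pos_def_def)
  have "\<mu> * ((Y *v v) \<bullet> w) = (X *v v) \<bullet> w" using assms by (simp add: is_gen_eigenvector_def)
  also have "\<dots> = v \<bullet> (X *v w)" by (rule sym_mat_inner[OF assms(1)])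
  also have "\<dots> = \<nu> * (v \<bullet> (Y *v w))" using assms by (simp add: is_gen_eigenvector_def)
  also have "\<dots> = \<nu> * ((Y *v v) \<bullet> w)" using sym_mat_inner[OF Y, of v w] by simp
  finally show ?thesis using assms(5) by simp
qed

text \<open>Eigenvectors of distinct eigenvalues are \<open>Y\<close>-orthogonal, hence independent.
  Finiteness matters because the sum defining \<open>gen_eigenvalues\<close> would otherwise
  collapse to the empty multiset.\<close>

lemma finite_gen_eigenvalues:
  fixes X Y :: "real^'n^'n"
  assumes "sym_mat X" "pos_def Y"
  shows "finite {\<mu>. is_gen_eigenvalue X Y \<mu>}"
proof -
  define E where "E = {\<mu>. is_gen_eigenvalue X Y \<mu>}"
  have "\<forall>\<mu>\<in>E. \<exists>v. is_gen_eigenvector X Y \<mu> v" by (simp add: E_def is_gen_eigenvalue_def)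
  then obtain v where "\<forall>\<mu>\<in>E. is_gen_eigenvector X Y \<mu> (v \<mu>)"
    by (rule bchoice[THEN exE])
  then have v: "is_gen_eigenvector X Y \<mu> (v \<mu>)" if "\<mu> \<in> E" for \<mu>
    using that by blast
  have inj: "inj_on v E"
    using v rayleigh_gen_eigenvector[OF assms(2)] by (metis inj_onI)
  have "independent (v ` E)"
    unfolding dependent_def
  proof
    assume "\<exists>a\<in>v ` E. a \<in> span (v ` E - {a})"
    then obtain \<mu> where \<mu>: "\<mu> \<in> E" "v \<mu> \<in> span (v ` E - {v \<mu>})" by blast
    have "orthogonal (Y *v v \<mu>) (v \<mu>)"
    proof (rule orthogonal_to_span[OF \<mu>(2)])
      fix y assume "y \<in> v ` E - {v \<mu>}"
      then obtain \<nu> where "\<nu> \<in> E" "y = v \<nu>" "\<nu> \<noteq> \<mu>" by blast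
      then show "orthogonal (Y *v v \<mu>) y"
        using gen_eigenvectors_orthogonal[OF assms v[OF \<mu>(1)] v] by (simp add: orthogonal_def)
    qed
    moreover have "v \<mu> \<noteq> 0" using v[OF \<mu>(1)] by (simp add: is_gen_eigenvector_def)
    ultimately show False
      using pos_def_quadratic_form_pos[OF assms(2), of "v \<mu>"]
      by (simp add: orthogonal_def inner_commute)
  qed
  then have "finite (v ` E)" by (rule independent_imp_finite)
  then show ?thesis using inj finite_imageD unfolding E_def by blast
qed

lemma rev_sorted_list_of_multiset_max:
  fixes M :: "'a::linorder multiset"
  assumes "\<And>a. a \<in># M \<Longrightarrow> a \<le> b"
  shows "rev (sorted_list_of_multiset M) =
    replicate (count M b) b @ rev (sorted_list_of_multiset (filter_mset (\<lambda>a. a \<noteq> b) M))"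
proof -
  let ?l = "sorted_list_of_multiset (filter_mset (\<lambda>a. a \<noteq> b) M) @ replicate (count M b) b"
  have "mset ?l = M" by (auto intro!: multiset_eqI)
  then have "sorted_list_of_multiset M = sort ?l" by (metis sorted_list_of_multiset_mset)
  also have "\<dots> = ?l"
    using assms by (intro sorted_sort_id) (auto simp: sorted_append)
  finally show ?thesis by simp
qed

text \<open>The dimension of the eigenspace is the count of \<open>\<mu>\<close> in the multiset,
  and all these copies come first in the decreasing list because every eigenvalue is a Rayleigh
  quotient.\<close>

lemma
  fixes X Y :: "real^'n^'n"
  assumes X: "sym_mat X" and Y: "pos_def Y" and v: "is_gen_eigenvector X Y \<mu> v"
    and max: "\<And>w. w \<noteq> 0 \<Longrightarrow> rayleigh X Y w \<le> \<mu>"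
  shows gen_eigval_1_eq: "gen_eigval 1 X Y = \<mu>"
    and dim_gen_eigenspace_le: "dim {v. X *v v = \<mu> *\<^sub>R (Y *v v)} \<le> max_gen_eigval_mult X Y"
proof -
  define k where "k = dim {v. X *v v = \<mu> *\<^sub>R (Y *v v)}"
  have "v \<noteq> 0" "X *v v = \<mu> *\<^sub>R (Y *v v)" using v by (auto simp: is_gen_eigenvector_def)
  then have "\<not> {v. X *v v = \<mu> *\<^sub>R (Y *v v)} \<subseteq> {0}" by blast
  then have "k > 0" unfolding k_def by (metis dim_eq_0 gr0I)
  have fin: "finite {\<mu>. is_gen_eigenvalue X Y \<mu>}" by (rule finite_gen_eigenvalues[OF X Y])
  have "is_gen_eigenvalue X Y \<mu>" using v by (auto simp: is_gen_eigenvalue_def)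
  then have count: "count (gen_eigenvalues X Y) \<mu> = k"
    using fin by (simp add: gen_eigenvalues_def count_sum k_def)
  have "a \<le> \<mu>" if "a \<in># gen_eigenvalues X Y" for a
  proof -
    have "count (gen_eigenvalues X Y) a \<noteq> 0" using that by simp
    then have "is_gen_eigenvalue X Y a"
      using fin by (simp add: gen_eigenvalues_def count_sum split: if_splits)
    then obtain w where "is_gen_eigenvector X Y a w" by (auto simp: is_gen_eigenvalue_def)
    then show ?thesis
      using rayleigh_gen_eigenvector[OF Y] max[of w] by (auto simp: is_gen_eigenvector_def)
  qed
  then have "rev (sorted_list_of_multiset (gen_eigenvalues X Y)) = replicate k \<mu> @
      rev (sorted_list_of_multiset (filter_mset (\<lambda>a. a \<noteq> \<mu>) (gen_eigenvalues X Y)))"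
    unfolding count[symmetric] by (rule rev_sorted_list_of_multiset_max)
  then have nth: "gen_eigval i X Y = \<mu>" if "i \<in> {1..k}" for i
    using that unfolding gen_eigval_def by (simp add: nth_append less_eq_Suc_le)
  show "gen_eigval 1 X Y = \<mu>" using \<open>k > 0\<close> by (intro nth) simp
  \<comment> \<open>Keeps the block \<open>{1..k}\<close> inside the index range over which the
    multiplicity counts.\<close>
  have "k \<le> CARD('n)" unfolding k_def by (rule dim_subset_UNIV_cart)
  then have "card {1..k} \<le> max_gen_eigval_mult X Y"
    unfolding max_gen_eigval_mult_def using nth \<open>k > 0\<close> by (intro card_mono) auto
  then show "dim {v. X *v v = \<mu> *\<^sub>R (Y *v v)} \<le> max_gen_eigval_mult X Y" by (simp add: k_def)
qed

text \<open>From here on the sorted list is replaced by this variational description of its first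
  entry.\<close>

lemma
  fixes X Y :: "real^'n^'n"
  assumes X: "sym_mat X" and Y: "pos_def Y"
  shows rayleigh_le_gen_eigval_1: "w \<noteq> 0 \<Longrightarrow> rayleigh X Y w \<le> gen_eigval 1 X Y"
    and gen_eigval_1_attained: "\<exists>v. norm v = 1 \<and> rayleigh X Y v = gen_eigval 1 X Y"
    and dim_top_gen_eigenspace_le:
      "dim {v. X *v v = gen_eigval 1 X Y *\<^sub>R (Y *v v)} \<le> max_gen_eigval_mult X Y"
proof -
  obtain v where v: "norm v = 1" "\<And>w. w \<noteq> 0 \<Longrightarrow> rayleigh X Y w \<le> rayleigh X Y v"
    using rayleigh_max_exists[OF Y, of X] by metis
  then have ev: "is_gen_eigenvector X Y (rayleigh X Y v) v"
    by (intro gen_eigenvector_rayleigh_max[OF X Y]) auto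
  have eq: "gen_eigval 1 X Y = rayleigh X Y v" by (rule gen_eigval_1_eq[OF X Y ev v(2)])
  show "w \<noteq> 0 \<Longrightarrow> rayleigh X Y w \<le> gen_eigval 1 X Y" using v eq by simp
  show "\<exists>v. norm v = 1 \<and> rayleigh X Y v = gen_eigval 1 X Y" using v eq by metis
  show "dim {v. X *v v = gen_eigval 1 X Y *\<^sub>R (Y *v v)} \<le> max_gen_eigval_mult X Y"
    unfolding eq by (rule dim_gen_eigenspace_le[OF X Y ev v(2)])
qed

lemma inner_congruence: "u \<bullet> ((transpose V ** W ** V) *v u) = (V *v u) \<bullet> (W *v (V *v u))"
  for V :: "real^'t^'n" and W :: "real^'n^'n"
  by (metis dot_lmul_matrix inner_commute matrix_vector_mul_assoc transpose_matrix_vector)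

text \<open>The normalisation makes \<open>V\<close> injective, so its range is a subspace of the
  eigenspace whose dimension, the multiplicity, is at least that of the eigenspace.\<close>

lemma top_gen_eigenspace_eq_range:
  fixes X Y :: "real^'n^'n" and V :: "real^'t^'n"
  assumes X: "sym_mat X" and Y: "pos_def Y"
    and t: "CARD('t) = max_gen_eigval_mult X Y"
    and col: "\<And>j. is_gen_eigenvector X Y (gen_eigval 1 X Y) (column j V)"
    and V: "transpose V ** Y ** V = mat 1"
  shows "{v. X *v v = gen_eigval 1 X Y *\<^sub>R (Y *v v)} = range ((*v) V)" (is "?E = _")
proof (rule subspace_dim_equal[symmetric])
  show "subspace (range ((*v) V))"
    by (intro linear_subspace_image matrix_vector_mul_linear subspace_UNIV)
  show E: "subspace ?E"
    by (auto simp: subspace_def matrix_vector_right_distrib matrix_vector_mult_scaleR scaleR_add_right)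
  show "range ((*v) V) \<subseteq> ?E"
  proof clarify
    fix u
    have "V *v u = (\<Sum>j\<in>UNIV. u $ j *\<^sub>R column j V)"
      by (simp add: matrix_mult_sum scalar_mult_eq_scaleR)
    also have "\<dots> \<in> ?E"
      using col by (intro subspace_sum[OF E] subspace_scale[OF E]) (simp add: is_gen_eigenvector_def)
    finally show "X *v (V *v u) = gen_eigval 1 X Y *\<^sub>R (Y *v (V *v u))" by simp
  qed
  have "u = 0" if "V *v u = 0" for u
    using inner_congruence[of u V Y] that V by simp
  then have "inj ((*v) V)"
    using linear_injective_0[OF matrix_vector_mul_linear] by blast
  then have "dim (range ((*v) V)) = CARD('t)"
    by (subst dim_image_eq[OF matrix_vector_mul_linear]) (auto simp: inj_on_subset)
  then show "dim ?E \<le> dim (range ((*v) V))"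
    using dim_top_gen_eigenspace_le[OF X Y] t by simp
qed

section \<open>The subdifferential of the maximum generalized eigenvalue\<close>

lemma open_pos_orthant: "open (pos_orthant :: (real^'m) set)"
proof -
  have "pos_orthant = (\<Inter>e. {x :: real^'m. 0 < x $ e})" by (auto simp: pos_orthant_def)
  also have "open \<dots>"
    by (intro open_INT finite ballI open_Collect_less continuous_on_component continuous_on_const continuous_on_id)
  finally show ?thesis .
qed

section \<open>Differentiating the Rayleigh quotient\<close>

lemma cont_diff_on_partial_deriv:
  fixes F :: "real^'m \<Rightarrow> 'b::real_normed_vector"
  assumes "cont_diff_on S F"
  shows "x \<in> S \<Longrightarrow> (F has_derivative (\<lambda>h. \<Sum>e\<in>UNIV. h $ e *\<^sub>R partial_deriv e F x)) (at x)"
    and "continuous_on S (partial_deriv e F)"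
proof -
  obtain F' where F': "\<And>x. x \<in> S \<Longrightarrow> (F has_derivative blinfun_apply (F' x)) (at x)"
    and cont: "continuous_on S F'"
    using assms unfolding cont_diff_on_def by blast
  have pd: "partial_deriv e F x = F' x (axis e 1)" if "x \<in> S" for x e
  proof -
    have "(F has_derivative blinfun_apply (F' x)) (at (x + 0 *\<^sub>R axis e 1))" using F'[OF that] by simp
    then have "((\<lambda>s. F (x + s *\<^sub>R axis e 1)) has_derivative (\<lambda>s. F' x (s *\<^sub>R axis e 1))) (at 0)"
      by (rule has_derivative_compose[rotated]) (auto intro!: derivative_eq_intros)
    then show ?thesis
      unfolding partial_deriv_def
      by (intro vector_derivative_at) (simp add: has_vector_derivative_def blinfun.scaleR_right)
  qed
  show "(F has_derivative (\<lambda>h. \<Sum>e\<in>UNIV. h $ e *\<^sub>R partial_deriv e F x)) (at x)" if x: "x \<in> S" for x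
  proof -
    have "blinfun_apply (F' x) h = (\<Sum>e\<in>UNIV. h $ e *\<^sub>R partial_deriv e F x)" for h
    proof -
      have "h = (\<Sum>e\<in>UNIV. h $ e *\<^sub>R axis e 1)"
        using basis_expansion[of h] by (simp add: scalar_mult_eq_scaleR)
      then have "F' x h = F' x (\<Sum>e\<in>UNIV. h $ e *\<^sub>R axis e 1)" by simp
      also have "\<dots> = (\<Sum>e\<in>UNIV. h $ e *\<^sub>R partial_deriv e F x)"
        using x by (simp add: blinfun.sum_right blinfun.scaleR_right pd)
      finally show ?thesis .
    qed
    then have "blinfun_apply (F' x) = (\<lambda>h. \<Sum>e\<in>UNIV. h $ e *\<^sub>R partial_deriv e F x)" by (rule ext)
    with F'[OF x] show ?thesis by simp
  qed
  show "continuous_on S (partial_deriv e F)"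
  proof -
    have "continuous_on S (\<lambda>x. F' x (axis e 1))" by (intro continuous_intros cont)
    then show ?thesis
      using continuous_on_cong[of S S "partial_deriv e F" "\<lambda>x. F' x (axis e 1)"] pd by simp
  qed
qed

text \<open>The quotient rule with one factor of the denominator cancelled: where the quotient
  equals the eigenvalue and the denominator is 1, the form of the matrix in the theorem
  remains.\<close>

definition rayleigh_grad where
  "rayleigh_grad A B y v = (\<chi> e. (v \<bullet> (partial_deriv e A y *v v) -
     rayleigh (A y) (B y) v * (v \<bullet> (partial_deriv e B y *v v))) / (v \<bullet> (B y *v v)))"

lemma bounded_linear_quadratic_form: "bounded_linear (\<lambda>M :: real^'n^'n. v \<bullet> (M *v v))"
  unfolding linear_conv_bounded_linear[symmetric]
  by (intro linearI) (simp_all add: matrix_vector_mult_add_rdistrib scaleR_matrix_vector_assoc[symmetric] inner_add_right)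

lemma GDERIV_rayleigh:
  fixes A B :: "real^'m \<Rightarrow> real^'n^'n"
  assumes "cont_diff_on S A" "cont_diff_on S B" "y \<in> S" "v \<bullet> (B y *v v) \<noteq> 0"
  shows "GDERIV (\<lambda>y. rayleigh (A y) (B y) v) y :> rayleigh_grad A B y v"
proof -
  interpret q: bounded_linear "\<lambda>M :: real^'n^'n. v \<bullet> (M *v v)" by (rule bounded_linear_quadratic_form)
  have quad: "((\<lambda>y. v \<bullet> (F y *v v)) has_derivative
      (\<lambda>h. \<Sum>e\<in>UNIV. h $ e * (v \<bullet> (partial_deriv e F y *v v)))) (at y)"
    if "cont_diff_on S F" for F :: "real^'m \<Rightarrow> real^'n^'n"
    using q.has_derivative[OF cont_diff_on_partial_deriv(1)[OF that assms(3)]]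
    by (simp add: q.sum q.scaleR)
  have "((\<lambda>y. rayleigh (A y) (B y) v) has_derivative
      (\<lambda>h. ((\<Sum>e\<in>UNIV. h $ e * (v \<bullet> (partial_deriv e A y *v v))) * (v \<bullet> (B y *v v)) -
        (v \<bullet> (A y *v v)) * (\<Sum>e\<in>UNIV. h $ e * (v \<bullet> (partial_deriv e B y *v v)))) /
        ((v \<bullet> (B y *v v)) * (v \<bullet> (B y *v v))))) (at y)"
    using has_derivative_divide'[OF quad[OF assms(1)] quad[OF assms(2)] assms(4)] .
  moreover have "((\<Sum>e\<in>UNIV. h $ e * (v \<bullet> (partial_deriv e A y *v v))) * (v \<bullet> (B y *v v)) -
        (v \<bullet> (A y *v v)) * (\<Sum>e\<in>UNIV. h $ e * (v \<bullet> (partial_deriv e B y *v v)))) /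
        ((v \<bullet> (B y *v v)) * (v \<bullet> (B y *v v))) = h \<bullet> rayleigh_grad A B y v" for h
  proof -
    define p a b where "p = v \<bullet> (B y *v v)"
      and "a e = v \<bullet> (partial_deriv e A y *v v)" and "b e = v \<bullet> (partial_deriv e B y *v v)" for e
    define r where "r = rayleigh (A y) (B y) v"
    have "h \<bullet> rayleigh_grad A B y v = (\<Sum>e\<in>UNIV. h $ e * ((a e - r * b e) / p))"
      unfolding inner_vec_def[of h] rayleigh_grad_def a_def b_def r_def p_def by simp
    also have "\<dots> = (\<Sum>e\<in>UNIV. h $ e * a e) / p - r * (\<Sum>e\<in>UNIV. h $ e * b e) / p"
      by (simp add: sum_divide_distrib sum_distrib_left sum_subtractf[symmetric]
          diff_divide_distrib right_diff_distrib mult_ac)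
    finally have "h \<bullet> rayleigh_grad A B y v = \<dots>" .
    moreover have "p \<noteq> 0" "r = (v \<bullet> (A y *v v)) / p" using assms(4) by (simp_all add: p_def r_def)
    ultimately show ?thesis
      unfolding a_def[symmetric] b_def[symmetric] p_def[symmetric] by (simp add: field_simps)
  qed
  ultimately show ?thesis by (simp add: gderiv_def)
qed

lemma smooth_max_rayleigh:
  fixes A B :: "real^'m \<Rightarrow> real^'n^'n"
  assumes "open S" "cont_diff_on S A" "cont_diff_on S B"
    and sym: "\<And>y. y \<in> S \<Longrightarrow> sym_mat (A y)" and pd: "\<And>y. y \<in> S \<Longrightarrow> pos_def (B y)"
  shows "smooth_max S (sphere 0 1) (\<lambda>y. rayleigh (A y) (B y)) (rayleigh_grad A B)
    (\<lambda>y. gen_eigval 1 (A y) (B y))"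
proof
  have nz: "v \<bullet> (B y *v v) \<noteq> 0" if "y \<in> S" "v \<in> sphere 0 1" for y v
  proof -
    have "v \<noteq> 0" using that by auto
    then show ?thesis using pos_def_quadratic_form_pos[OF pd[OF that(1)], of v] by simp
  qed
  show "open S" "compact (sphere (0::real^'n) 1)" using assms by auto
  show "GDERIV (\<lambda>y. rayleigh (A y) (B y) v) y :> rayleigh_grad A B y v"
    if "y \<in> S" "v \<in> sphere 0 1" for y v
    using GDERIV_rayleigh[OF assms(2,3) that(1) nz[OF that]] .
  have comp: "continuous_on (S \<times> sphere (0::real^'n) 1) (\<lambda>z. F (fst z))"
    if "continuous_on S F" for F :: "real^'m \<Rightarrow> real^'n^'n"
    by (rule continuous_on_compose2[OF that]) (auto intro: continuous_intros)
  have cF: "continuous_on S F" if "cont_diff_on S F" for F :: "real^'m \<Rightarrow> real^'n^'n"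
    using cont_diff_on_partial_deriv(1)[OF that]
    by (meson continuous_at_imp_continuous_on has_derivative_continuous)
  note quad = continuous_on_quadratic_form[OF comp continuous_on_snd[OF continuous_on_id]]
  have ray: "continuous_on (S \<times> sphere 0 1) (\<lambda>z. rayleigh (A (fst z)) (B (fst z)) (snd z))"
    by (intro continuous_on_divide quad cF assms) (use nz in auto)
  then show "continuous_on (S \<times> sphere 0 1) (\<lambda>(y, v). rayleigh (A y) (B y) v)"
    by (simp add: case_prod_unfold)
  show "continuous_on (S \<times> sphere 0 1) (\<lambda>(y, v). rayleigh_grad A B y v)"
    unfolding rayleigh_grad_def case_prod_unfold
    by (intro continuous_on_vec_lambda continuous_on_divide continuous_on_diff continuous_on_mult
        ray quad cF cont_diff_on_partial_deriv(2) assms) (use nz in auto)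
  show "rayleigh (A y) (B y) v \<le> gen_eigval 1 (A y) (B y)" if "y \<in> S" "v \<in> sphere 0 1" for y v
  proof -
    have "v \<noteq> 0" using that by auto
    then show ?thesis by (rule rayleigh_le_gen_eigval_1[OF sym[OF that(1)] pd[OF that(1)]])
  qed
  show "\<exists>v\<in>sphere 0 1. rayleigh (A y) (B y) v = gen_eigval 1 (A y) (B y)" if "y \<in> S" for y
    using gen_eigval_1_attained[OF sym[OF that] pd[OF that]] by auto
qed

lemma rayleigh_grad_scaleR:
  assumes "c \<noteq> 0"
  shows "rayleigh_grad A B y (c *\<^sub>R v) = rayleigh_grad A B y v"
proof -
  have "(c * (c * a) - r * (c * (c * b))) / (c * (c * d)) = (a - r * b) / d" for a b d r :: real
  proof -
    have "c * (c * a) - r * (c * (c * b)) = (c * c) * (a - r * b)" by (simp add: algebra_simps)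
    then show ?thesis using assms by simp
  qed
  then show ?thesis
    unfolding rayleigh_grad_def rayleigh_scaleR[OF assms]
    by (simp only: matrix_vector_mult_scaleR inner_scaleR_left inner_scaleR_right)
qed

theorem theorem4:
  fixes A B :: "real ^ 'm \<Rightarrow> real ^ 'n ^ 'n"
    and x :: "real ^ 'm"
    and V :: "real ^ 't ^ 'n"
  assumes "cont_diff_on pos_orthant A"
    and "cont_diff_on pos_orthant B"
    and "\<And>y. y \<in> pos_orthant \<Longrightarrow> sym_mat (A y)"
    and "\<And>y. y \<in> pos_orthant \<Longrightarrow> pos_def (B y)"
    and "x \<in> pos_orthant"
    and "CARD('t) = max_gen_eigval_mult (A x) (B x)"
    and "\<And>j. is_gen_eigenvector (A x) (B x) (gen_eigval 1 (A x) (B x)) (column j V)"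
    and "transpose V ** B x ** V = mat 1"
  shows "clarke_subdiff pos_orthant (\<lambda>y. gen_eigval 1 (A y) (B y)) x =
    {g. \<exists>U \<in> spectraplex. g = (\<chi> e. mat_inner U
          (transpose V **
           (partial_deriv e A x - gen_eigval 1 (A x) (B x) *\<^sub>R partial_deriv e B x) ** V))}"
proof -
  let ?\<mu> = "gen_eigval 1 (A x) (B x)"
  define W where "W e = partial_deriv e A x - ?\<mu> *\<^sub>R partial_deriv e B x" for e
  define L :: "real^'t^'t \<Rightarrow> real^'m" where "L U = (\<chi> e. mat_inner U (transpose V ** W e ** V))" for U
  note X = assms(3)[OF assms(5)] and Y = assms(4)[OF assms(5)]
  note range = top_gen_eigenspace_eq_range[OF X Y assms(6-8)]
  \<comment> \<open>\<open>V\<close> is an isometry from the Euclidean norm to the norm given by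
    \<open>B x\<close>, so unit \<open>u\<close> give denominator 1.\<close>
  have norm: "(V *v u) \<bullet> (B x *v (V *v u)) = u \<bullet> u" for u
    using inner_congruence[of u V "B x"] assms(8) by simp
  have ray: "rayleigh (A x) (B x) (V *v u) = ?\<mu>" if "u \<noteq> 0" for u
  proof -
    have "A x *v (V *v u) = ?\<mu> *\<^sub>R (B x *v (V *v u))" using range by blast
    then show ?thesis using norm[of u] that by simp
  qed
  have grad: "rayleigh_grad A B x (V *v u) = L (outer u)" if "norm u = 1" for u
  proof -
    have "u \<noteq> 0" "u \<bullet> u = 1" using that by (auto simp: dot_square_norm)
    then show ?thesis
      unfolding rayleigh_grad_def L_def ray[OF \<open>u \<noteq> 0\<close>] unfolding norm
      by (simp add: mat_inner_outer inner_congruence W_def matrix_vector_mult_diff_rdistrib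
          scaleR_matrix_vector_assoc[symmetric] inner_diff_right)
  qed
  have "linear L"
    by (intro linearI) (simp_all add: L_def vec_eq_iff mat_inner_add_left mat_inner_scaleR_left)
  interpret smooth_max pos_orthant "sphere 0 1" "\<lambda>y. rayleigh (A y) (B y)" "rayleigh_grad A B"
    "\<lambda>y. gen_eigval 1 (A y) (B y)"
    by (rule smooth_max_rayleigh[OF open_pos_orthant assms(1-4)])
  \<comment> \<open>The \<open>v\<close> have Euclidean norm 1, the \<open>V *v u\<close> have norm
    1 with respect to \<open>B x\<close>; rescaling matches them in both directions.\<close>
  have "{rayleigh_grad A B x v |v. v \<in> sphere 0 1 \<and> rayleigh (A x) (B x) v = ?\<mu>} =
    L ` outer ` {u. norm u = 1}" (is "?G = _")
  proof (intro equalityI subsetI)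
    fix g assume "g \<in> ?G"
    then obtain v where v: "norm v = 1" "rayleigh (A x) (B x) v = ?\<mu>" "g = rayleigh_grad A B x v"
      by auto
    then have "v \<noteq> 0" by auto
    have "is_gen_eigenvector (A x) (B x) ?\<mu> v"
      using gen_eigenvector_rayleigh_max[OF X Y \<open>v \<noteq> 0\<close>] rayleigh_le_gen_eigval_1[OF X Y] v(2) by simp
    then have "v \<in> range ((*v) V)" using range by (auto simp: is_gen_eigenvector_def)
    then obtain u where u: "v = V *v u" by blast
    have "u \<noteq> 0" using u \<open>v \<noteq> 0\<close> by auto
    then have "rayleigh_grad A B x v = rayleigh_grad A B x (V *v (u /\<^sub>R norm u))"
      using u by (simp add: matrix_vector_mult_scaleR rayleigh_grad_scaleR)
    also have "\<dots> = L (outer (u /\<^sub>R norm u))" using \<open>u \<noteq> 0\<close> by (intro grad) simp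
    finally show "g \<in> L ` outer ` {u. norm u = 1}" using v \<open>u \<noteq> 0\<close> by auto
  next
    fix g assume "g \<in> L ` outer ` {u. norm u = 1}"
    then obtain u where u: "norm u = 1" "g = L (outer u)" by blast
    then have "u \<noteq> 0" by auto
    define v where "v = V *v u"
    have "v \<noteq> 0" using norm[of u] \<open>u \<noteq> 0\<close> by (auto simp: v_def)
    then have "g = rayleigh_grad A B x (v /\<^sub>R norm v)" "rayleigh (A x) (B x) (v /\<^sub>R norm v) = ?\<mu>"
      using grad[OF u(1)] u ray[OF \<open>u \<noteq> 0\<close>] rayleigh_scaleR[of "inverse (norm v)" v "A x" "B x"]
      by (simp_all add: v_def rayleigh_grad_scaleR)
    with \<open>v \<noteq> 0\<close> show "g \<in> ?G" by (intro CollectI exI[of _ "v /\<^sub>R norm v"]) auto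
  qed
  \<comment> \<open>A linear image commutes with the convex hull, and the hull of the rank one
    matrices is the spectraplex.\<close>
  then have "clarke_subdiff pos_orthant (\<lambda>y. gen_eigval 1 (A y) (B y)) x = L ` spectraplex"
    using clarke_subdiff_eq[OF assms(5)]
    by (simp add: spectraplex_eq_hull convex_hull_linear_image[OF \<open>linear L\<close>])
  then show ?thesis by (auto simp: L_def W_def)
qed

end
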